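(* For every integer $n \ge 1$, let $f(n)$ be the maximum, over all cyclic permutations $\pi$ of order $n$, of the minimum number of adjacent swaps needed to transform $\pi$ into the trivial cyclic permutation $u=(1,2,\ldots,n)$. Then \[ f(n) = \left\lfloor \frac{(n-1)^2}{4} \right\rfloor. \]
   Context: A cyclic permutation of order $n$ is a bijective labeling of the vertices of a cycle of length $n$ by the elements of $[n]=\{1,\ldots,n\}$, where two labelings that differ by a rotation of the cycle (a cyclic shift) are considered the same; reflections are not identified. An adjacent swap transforms a cyclic permutation into the one obtained by exchanging the labels of two vertices that are adjacent along the cycle. The trivial cyclic permutation $u=(1,2,\ldots,n)$ is the labeling in which the labels $1,2,\ldots,n$ appear consecutively around the cycle in this order. Equivalently, $f(n)$ is the diameter of the graph whose vertices are the cyclic permutations of order $n$, two being adjacent iff one is obtained from the other by a single adjacent swap. *)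

theory Defs
  imports Complex_Main "HOL-Library.Extended_Nat"
begin

text \<open>
  A labeling of the \<open>n\<close>-cycle is a list \<open>xs\<close> of length \<open>n\<close>; the vertices of the cycle are the
  positions \<open>0, \<dots>, n - 1\<close>, with \<open>i\<close> followed by \<open>(i + 1) mod n\<close>.
\<close>

definition labelings :: "nat \<Rightarrow> nat list set" where
  "labelings n = {xs. distinct xs \<and> set xs = {1..n}}"

definition rotation_rel :: "nat \<Rightarrow> (nat list \<times> nat list) set" where
  "rotation_rel n = {(xs, ys). xs \<in> labelings n \<and> (\<exists>k. ys = rotate k xs)}"

definition cyclic_perms :: "nat \<Rightarrow> nat list set set" where
  "cyclic_perms n = labelings n // rotation_rel n"

definition trivial_cyclic_perm :: "nat \<Rightarrow> nat list set" where
  "trivial_cyclic_perm n = rotation_rel n `` {[1..<Suc n]}"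

definition swap_labels :: "nat list \<Rightarrow> nat \<Rightarrow> nat \<Rightarrow> nat list" where
  "swap_labels xs i j = xs[i := xs ! j, j := xs ! i]"

text \<open>
  The condition \<open>i \<noteq> j\<close> only matters for \<open>n = 1\<close>, where there are no two adjacent vertices.
  For \<open>n = 2\<close> the swap exists but leads back to the same cyclic permutation.
\<close>

definition adjacent_swap :: "nat \<Rightarrow> (nat list set \<times> nat list set) set" where
  "adjacent_swap n = {(P, Q). P \<in> cyclic_perms n \<and> Q \<in> cyclic_perms n \<and>
     (\<exists>xs\<in>P. \<exists>i<n. \<exists>j<n. i \<noteq> j \<and> j = (i + 1) mod n \<and> swap_labels xs i j \<in> Q)}"

text \<open>
  The value is \<open>\<infinity>\<close>, the infimum of the empty set, if \<open>Q\<close> cannot be reached from \<open>P\<close>.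
\<close>

definition swap_distance :: "nat \<Rightarrow> nat list set \<Rightarrow> nat list set \<Rightarrow> enat" where
  "swap_distance n P Q = (INF k\<in>{k. (P, Q) \<in> adjacent_swap n ^^ k}. enat k)"

definition max_swap_distance :: "nat \<Rightarrow> enat" where
  "max_swap_distance n = Max ((\<lambda>P. swap_distance n P (trivial_cyclic_perm n)) ` cyclic_perms n)"

end

theory Submission
  imports Defs
begin

text \<open>
  Lower bound: a rotation reverses the relative order of exactly the pairs of labels separated by
  some cut of the label set, and an adjacent swap, up to such a cut, of a single pair. The reversal
  has to change all pairs, so up to a cut all pairs inside its two sides are swapped, and two cliques
  on \<open>n\<close> vertices in total have at least \<open>\<lfloor>(n - 1)\<^sup>2 / 4\<rfloor>\<close> edges.

  Upper bound: unrolled to the integers, a labeling is an affine permutation, determined only up to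
  the choice of representatives of the labels modulo \<open>n\<close>, and adjacent swaps are simple reflections.
  Removing descents sorts it in as many swaps as its Coxeter length. Choose the representatives at
  distance at least \<open>t\<close> and less than \<open>t + n\<close> from their positions and average the length over \<open>t\<close>:
  a pair of positions contributes \<open>\<bar>p - q\<bar> / n\<close>, where \<open>p\<close> and \<open>q\<close> are the differences of its labels
  and of its positions modulo \<open>n\<close>. For a fixed first position, both \<open>p\<close> and \<open>q\<close> run through
  \<open>1, \<dots>, n - 1\<close>, and \<open>2 \<bar>p - q\<bar> \<le> \<bar>2 p - n\<bar> + \<bar>2 q - n\<bar>\<close> bounds the average by \<open>\<lfloor>(n - 1)\<^sup>2 / 4\<rfloor>\<close>.
\<close>


section \<open>Labelings and cyclic permutations\<close>

lemma length_labeling: "xs \<in> labelings n \<Longrightarrow> length xs = n"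
  unfolding labelings_def using distinct_card by fastforce

lemma finite_labelings: "finite (labelings n)"
  by (rule finite_subset[OF _ finite_subset_distinct[of "{1..n}"]]) (auto simp: labelings_def)

lemma rotate_labeling: "xs \<in> labelings n \<Longrightarrow> rotate k xs \<in> labelings n"
  by (simp add: labelings_def)

lemma length_swap_labels [simp]: "length (swap_labels xs i j) = length xs"
  by (simp add: swap_labels_def)

lemma nth_swap_labels:
  assumes "i < length xs" "j < length xs" "l < length xs"
  shows "swap_labels xs i j ! l = (if l = j then xs ! i else if l = i then xs ! j else xs ! l)"
  using assms by (simp add: swap_labels_def nth_list_update)

lemma swap_labeling:
  assumes "xs \<in> labelings n" "i < n" "j < n"
  shows "swap_labels xs i j \<in> labelings n"
  using assms length_labeling[of xs n]
  by (simp add: labelings_def swap_labels_def set_swap distinct_swap)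

lemma upt_labeling: "[1..<Suc n] \<in> labelings n"
  by (auto simp: labelings_def)

lemma rev_upt_labeling: "rev [1..<Suc n] \<in> labelings n"
  by (auto simp: labelings_def)

lemma rotate_rotate_inverse: "rotate (length xs - k mod length xs) (rotate k xs) = xs"
proof (cases "xs = []")
  case False
  have "rotate (length xs - k mod length xs) (rotate k xs)
      = rotate (length xs - k mod length xs) (rotate (k mod length xs) xs)"
    using rotate_conv_mod[of k xs] by simp
  then show ?thesis
    using False by (simp add: rotate_rotate less_imp_le)
qed simp

lemma equiv_rotation_rel: "equiv (labelings n) (rotation_rel n)"
proof (rule equivI)
  show "rotation_rel n \<subseteq> labelings n \<times> labelings n"
    by (auto simp: rotation_rel_def rotate_labeling)
  show "refl_on (labelings n) (rotation_rel n)"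
    by (auto simp: rotation_rel_def refl_on_def intro: exI[of _ 0])
  show "sym (rotation_rel n)"
    by (rule symI) (auto simp: rotation_rel_def rotate_labeling intro: rotate_rotate_inverse[symmetric])
  show "trans (rotation_rel n)"
    by (rule transI) (auto simp: rotation_rel_def rotate_rotate)
qed

lemma rotation_class_in_cyclic_perms:
  "xs \<in> labelings n \<Longrightarrow> rotation_rel n `` {xs} \<in> cyclic_perms n"
  unfolding cyclic_perms_def by (rule quotientI)

lemma in_rotation_class: "xs \<in> labelings n \<Longrightarrow> xs \<in> rotation_rel n `` {xs}"
  by (rule equiv_class_self[OF equiv_rotation_rel])

lemma finite_cyclic_perms: "finite (cyclic_perms n)"
  unfolding cyclic_perms_def
  using finite_labelings equiv_rotation_rel by (intro finite_quotient) (auto simp: equiv_def)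

lemma cyclic_perm_subset_labelings: "P \<in> cyclic_perms n \<Longrightarrow> P \<subseteq> labelings n"
  unfolding cyclic_perms_def by (rule in_quotient_imp_subset[OF equiv_rotation_rel])

lemma cyclic_perm_rotateE:
  assumes "P \<in> cyclic_perms n" "xs \<in> P" "ys \<in> P"
  obtains k where "ys = rotate k xs"
  using in_quotient_imp_in_rel[OF equiv_rotation_rel, of P n xs ys] assms
  by (auto simp: cyclic_perms_def rotation_rel_def)

lemma rotation_class_upt_eq: "rotation_rel n `` {rotate k [1..<Suc n]} = trivial_cyclic_perm n"
proof -
  have "([1..<Suc n], rotate k [1..<Suc n]) \<in> rotation_rel n"
    using upt_labeling[of n] unfolding rotation_rel_def by blast
  then show ?thesis
    unfolding trivial_cyclic_perm_def by (rule equiv_class_eq[OF equiv_rotation_rel, symmetric])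
qed

lemma adjacent_swapI:
  assumes xs: "xs \<in> labelings n" and "i < n" "2 \<le> n"
  shows "(rotation_rel n `` {xs}, rotation_rel n `` {swap_labels xs i ((i + 1) mod n)})
    \<in> adjacent_swap n"
proof -
  let ?j = "(i + 1) mod n"
  have j: "?j < n" "i \<noteq> ?j"
    using assms by (auto simp: mod_Suc)
  have ys: "swap_labels xs i ?j \<in> labelings n"
    using swap_labeling[OF xs \<open>i < n\<close> j(1)] .
  show ?thesis
    unfolding adjacent_swap_def
    using rotation_class_in_cyclic_perms[OF xs] rotation_class_in_cyclic_perms[OF ys]
      in_rotation_class[OF xs] in_rotation_class[OF ys] \<open>i < n\<close> j by blast
qed


section \<open>Pairs of labels that change their relative order\<close>

primrec precedence :: "'a list \<Rightarrow> ('a \<times> 'a) set" where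
  "precedence [] = {}"
| "precedence (x # xs) = {x} \<times> set xs \<union> precedence xs"

lemma precedence_subset: "precedence xs \<subseteq> set xs \<times> set xs"
  by (induction xs) auto

lemma finite_precedence: "finite (precedence xs)"
  by (rule finite_subset[OF precedence_subset]) simp

lemma precedence_append: "precedence (xs @ ys) = precedence xs \<union> precedence ys \<union> set xs \<times> set ys"
  by (induction xs) auto

lemma precedence_rev: "precedence (rev xs) = (precedence xs)\<inverse>"
  by (induction xs) (auto simp: precedence_append)

lemma precedence_Un_converse:
  "distinct xs \<Longrightarrow> precedence xs \<union> (precedence xs)\<inverse> = set xs \<times> set xs - Id"
  by (induction xs) (auto dest: subsetD[OF precedence_subset])

lemma precedence_Int_converse: "distinct xs \<Longrightarrow> precedence xs \<inter> (precedence xs)\<inverse> = {}"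
  by (induction xs) (auto dest: subsetD[OF precedence_subset])

definition order_changes :: "'a list \<Rightarrow> 'a list \<Rightarrow> ('a \<times> 'a) set" where
  "order_changes xs ys = sym_diff (precedence xs) (precedence ys)"

lemma order_changes_commute: "order_changes xs ys = order_changes ys xs"
  by (auto simp: order_changes_def)

lemma finite_order_changes: "finite (order_changes xs ys)"
  by (simp add: order_changes_def finite_precedence)

lemma order_changes_rev:
  assumes "distinct xs"
  shows "order_changes (rev xs) xs = set xs \<times> set xs - Id"
  using precedence_Un_converse[OF assms] precedence_Int_converse[OF assms]
  unfolding order_changes_def precedence_rev by blast

definition cut_pairs :: "'a set \<Rightarrow> 'a set \<Rightarrow> ('a \<times> 'a) set" where
  "cut_pairs A S = {(a, b) \<in> A \<times> A. (a \<in> S) \<noteq> (b \<in> S)}"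

lemma order_changes_append_commute:
  assumes "distinct (us @ vs)"
  shows "order_changes (us @ vs) (vs @ us) = cut_pairs (set (us @ vs)) (set us)"
  using assms precedence_subset[of us] precedence_subset[of vs]
  by (auto simp: order_changes_def precedence_append cut_pairs_def)

lemma finite_cut_pairs: "finite A \<Longrightarrow> finite (cut_pairs A S)"
  by (rule finite_subset[of _ "A \<times> A"]) (auto simp: cut_pairs_def)

lemma cut_pairs_sym_diff: "cut_pairs A (sym_diff S T) = sym_diff (cut_pairs A S) (cut_pairs A T)"
  by (auto simp: cut_pairs_def)

text \<open>
  Rotating a list reverses the relative order of exactly the pairs separated by a cut, so the number
  of order changes is a function of cyclic permutations only after minimizing over all cuts.
\<close>

definition order_discrepancy :: "'a set \<Rightarrow> 'a list \<Rightarrow> 'a list \<Rightarrow> nat" where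
  "order_discrepancy A xs ys =
    (INF S. card (sym_diff (order_changes xs ys) (cut_pairs A S)))"

lemma order_discrepancy_le:
  "order_discrepancy A xs ys \<le> card (sym_diff (order_changes xs ys) (cut_pairs A S))"
  unfolding order_discrepancy_def by (rule cINF_lower) auto

lemma order_discrepancyE:
  obtains S where "order_discrepancy A xs ys = card (sym_diff (order_changes xs ys) (cut_pairs A S))"
proof -
  let ?d = "\<lambda>S. card (sym_diff (order_changes xs ys) (cut_pairs A S))"
  have "Inf (range ?d) \<in> range ?d"
    by (rule Inf_nat_def1) simp
  then show thesis
    using that unfolding order_discrepancy_def by blast
qed

lemma order_discrepancy_triangle:
  assumes "finite A"
  shows "order_discrepancy A xs zs \<le> order_discrepancy A xs ys + order_discrepancy A ys zs"
proof -
  let ?D = "\<lambda>us vs S. sym_diff (order_changes us vs) (cut_pairs A S)"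
  obtain S where S: "order_discrepancy A xs ys = card (?D xs ys S)"
    by (rule order_discrepancyE)
  obtain T where T: "order_discrepancy A ys zs = card (?D ys zs T)"
    by (rule order_discrepancyE)
  have fin: "finite (?D us vs R)" for us vs R
    using assms by (simp add: finite_order_changes finite_cut_pairs)
  have "?D xs zs (sym_diff S T) \<subseteq> ?D xs ys S \<union> ?D ys zs T"
    unfolding cut_pairs_sym_diff order_changes_def by blast
  then have "card (?D xs zs (sym_diff S T)) \<le> card (?D xs ys S \<union> ?D ys zs T)"
    by (rule card_mono[OF finite_UnI[OF fin fin]])
  also have "\<dots> \<le> order_discrepancy A xs ys + order_discrepancy A ys zs"
    unfolding S T by (rule card_Un_le)
  finally show ?thesis
    using order_discrepancy_le[of A xs zs "sym_diff S T"] by linarith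
qed

lemma order_discrepancy_commute: "order_discrepancy A xs ys = order_discrepancy A ys xs"
  by (simp add: order_discrepancy_def order_changes_commute)

lemma order_discrepancy_rotate:
  assumes "distinct xs"
  shows "order_discrepancy (set xs) xs (rotate k xs) = 0"
proof -
  let ?us = "take (k mod length xs) xs" and ?vs = "drop (k mod length xs) xs"
  have "order_changes xs (rotate k xs) = cut_pairs (set xs) (set ?us)"
    using order_changes_append_commute[of ?us ?vs] assms
    by (simp add: rotate_drop_take del: set_append)
  then show ?thesis
    using order_discrepancy_le[of "set xs" xs "rotate k xs" "set ?us"] by simp
qed

lemma order_discrepancy_swap_first_two:
  assumes "2 \<le> length xs"
  shows "order_discrepancy A xs (swap_labels xs 0 1) \<le> 2"
proof -
  obtain a b vs where xs: "xs = a # b # vs"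
    using assms by (auto simp: numeral_2_eq_2 Suc_le_length_iff)
  have "order_discrepancy A xs (swap_labels xs 0 1)
      \<le> card (order_changes (a # b # vs) (b # a # vs))"
    using order_discrepancy_le[of A xs "swap_labels xs 0 1" "{}"]
    by (simp add: cut_pairs_def swap_labels_def xs)
  also have "\<dots> \<le> card {(a, b), (b, a)}"
    by (rule card_mono) (simp, auto simp: order_changes_def)
  also have "\<dots> \<le> 2"
    by (cases "a = b") auto
  finally show ?thesis .
qed

lemma rotate_swap_labels:
  assumes "i < length xs" "2 \<le> length xs"
  shows "rotate i (swap_labels xs i ((i + 1) mod length xs)) = swap_labels (rotate i xs) 0 1"
    (is "rotate i (swap_labels xs i ?j) = _")
proof (rule nth_equalityI)
  fix l assume "l < length (rotate i (swap_labels xs i ?j))"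
  then have l: "l < length xs" by simp
  have shift: "(i + k) mod length xs = (if i + k < length xs then i + k else i + k - length xs)"
    if "k < length xs" for k
    using that assms by (simp add: le_mod_geq)
  have shift_eq_iff: "(i + l) mod length xs = i \<longleftrightarrow> l = 0" "(i + l) mod length xs = ?j \<longleftrightarrow> l = 1"
    using shift[OF l] shift[of 1] l assms by auto
  have "rotate i (swap_labels xs i ?j) ! l = swap_labels xs i ?j ! ((i + l) mod length xs)"
    using l by (simp add: nth_rotate)
  also have "\<dots> = (if l = 1 then xs ! i else if l = 0 then xs ! ?j else xs ! ((i + l) mod length xs))"
    using assms(1) l by (subst nth_swap_labels) (auto simp only: shift_eq_iff mod_less_divisor)
  also have "\<dots> = swap_labels (rotate i xs) 0 1 ! l"
    using assms l by (subst nth_swap_labels) (auto simp: nth_rotate simp flip: length_greater_0_conv)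
  finally show "rotate i (swap_labels xs i ?j) ! l = swap_labels (rotate i xs) 0 1 ! l" .
qed simp

lemma order_discrepancy_swap_labels:
  assumes xs: "distinct xs" and i: "i < length xs" and two: "2 \<le> length xs"
  shows "order_discrepancy (set xs) xs (swap_labels xs i ((i + 1) mod length xs)) \<le> 2"
proof -
  let ?ys = "swap_labels xs i ((i + 1) mod length xs)" and ?d = "order_discrepancy (set xs)"
  note triangle = order_discrepancy_triangle[OF finite_set, of xs]
  have "(i + 1) mod length xs < length xs"
    using i by (intro mod_less_divisor) linarith
  then have ys: "distinct ?ys" "set ?ys = set xs"
    using xs i by (simp_all add: swap_labels_def)
  have "?d xs (rotate i xs) = 0"
    using order_discrepancy_rotate[OF xs] .
  moreover have "?d (rotate i xs) (rotate i ?ys) \<le> 2"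
    using order_discrepancy_swap_first_two[of "rotate i xs"] rotate_swap_labels[OF i two] two by simp
  moreover have "?d (rotate i ?ys) ?ys = 0"
    using order_discrepancy_rotate[OF ys(1), of i] ys(2) by (simp add: order_discrepancy_commute)
  ultimately show ?thesis
    using triangle[of xs ?ys "rotate i xs"] triangle[of "rotate i xs" ?ys "rotate i ?ys"]
    by linarith
qed

lemma order_discrepancy_same_class:
  assumes "P \<in> cyclic_perms n" "xs \<in> P" "ys \<in> P"
  shows "order_discrepancy {1..n} xs ys = 0"
proof -
  obtain k where "ys = rotate k xs"
    using cyclic_perm_rotateE[OF assms] .
  moreover have "xs \<in> labelings n"
    using assms cyclic_perm_subset_labelings by blast
  ultimately show ?thesis
    using order_discrepancy_rotate[of xs k] by (simp add: labelings_def)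
qed

lemma order_discrepancy_adjacent_swap:
  assumes "(P, Q) \<in> adjacent_swap n" "xs \<in> P" "ys \<in> Q"
  shows "order_discrepancy {1..n} xs ys \<le> 2"
proof -
  let ?d = "order_discrepancy {1..n}"
  note triangle = order_discrepancy_triangle[of "{1..n}", OF finite_atLeastAtMost]
  from assms(1) obtain zs i where PQ: "P \<in> cyclic_perms n" "Q \<in> cyclic_perms n"
    and zs: "zs \<in> P" and i: "i < n" "i \<noteq> (i + 1) mod n"
    and swap: "swap_labels zs i ((i + 1) mod n) \<in> Q" (is "?zs \<in> Q")
    by (auto simp: adjacent_swap_def)
  have "zs \<in> labelings n"
    using zs PQ cyclic_perm_subset_labelings by blast
  moreover have "2 \<le> n"
    using i by (cases "n = 1") auto
  ultimately have "?d zs ?zs \<le> 2"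
    using order_discrepancy_swap_labels[of zs i] i length_labeling[of zs n]
    by (simp add: labelings_def)
  then show ?thesis
    using triangle[of xs ys zs] triangle[of zs ys ?zs]
      order_discrepancy_same_class[OF PQ(1) assms(2) zs]
      order_discrepancy_same_class[OF PQ(2) swap assms(3)] by linarith
qed

lemma order_discrepancy_relpow_adjacent_swap:
  assumes "(P, Q) \<in> adjacent_swap n ^^ k" "P \<in> cyclic_perms n" "xs \<in> P" "ys \<in> Q"
  shows "order_discrepancy {1..n} xs ys \<le> 2 * k"
  using assms
proof (induction k arbitrary: Q ys)
  case 0
  then show ?case
    using order_discrepancy_same_class[of P n xs ys] by simp
next
  case (Suc k)
  then obtain R where R: "(P, R) \<in> adjacent_swap n ^^ k" "(R, Q) \<in> adjacent_swap n"
    by auto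
  then obtain zs where zs: "zs \<in> R"
    by (auto simp: adjacent_swap_def)
  have "order_discrepancy {1..n} xs zs \<le> 2 * k"
    using Suc.IH[OF R(1) Suc.prems(2,3) zs] .
  moreover have "order_discrepancy {1..n} zs ys \<le> 2"
    using order_discrepancy_adjacent_swap[OF R(2) zs Suc.prems(4)] .
  ultimately show ?case
    using order_discrepancy_triangle[of "{1..n}" xs ys zs] by simp
qed

lemma card_Times_self_minus_Id:
  assumes "finite A"
  shows "card (A \<times> A - Id) = card A * (card A - 1)"
proof -
  have "A \<times> A - Id = (SIGMA a:A. A - {a})"
    by auto
  then show ?thesis
    using assms by (simp add: card_Diff_singleton)
qed

lemma double_quarter_square_le_two_cliques:
  fixes p q :: nat
  shows "2 * ((p + q - 1)\<^sup>2 div 4) \<le> p * (p - 1) + q * (q - 1)"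
proof (cases "p + q = 0")
  case False
  have pred: "int (m * (m - 1)) = int m * (int m - 1)" for m
    by (cases m) (auto simp: algebra_simps)
  have "int ((p + q - 1)\<^sup>2) = (int p + int q - 1)\<^sup>2"
    using False by (simp add: of_nat_diff Suc_le_eq)
  also have "\<dots> + (int p - int q)\<^sup>2 = 2 * int (p * (p - 1) + q * (q - 1)) + 1"
    unfolding of_nat_add pred by (simp add: algebra_simps power2_eq_square)
  finally have "int ((p + q - 1)\<^sup>2) \<le> 2 * int (p * (p - 1) + q * (q - 1)) + 1"
    using zero_le_power2[of "int p - int q"] by linarith
  then have "(p + q - 1)\<^sup>2 \<le> 2 * (p * (p - 1) + q * (q - 1)) + 1"
    by linarith
  moreover have "2 * (x div 4) \<le> m" if "x \<le> 2 * m + 1" for x m :: nat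
    using that by linarith
  ultimately show ?thesis
    by blast
qed simp

lemma order_discrepancy_rev_ge:
  assumes "distinct xs"
  shows "2 * ((length xs - 1)\<^sup>2 div 4) \<le> order_discrepancy (set xs) (rev xs) xs"
proof -
  obtain S where S: "order_discrepancy (set xs) (rev xs) xs
      = card (sym_diff (order_changes (rev xs) xs) (cut_pairs (set xs) S))"
    by (rule order_discrepancyE)
  let ?S = "set xs \<inter> S" and ?T = "set xs - S"
  have "sym_diff (order_changes (rev xs) xs) (cut_pairs (set xs) S)
      = (?S \<times> ?S - Id) \<union> (?T \<times> ?T - Id)"
    by (auto simp: order_changes_rev[OF assms] cut_pairs_def)
  then have "order_discrepancy (set xs) (rev xs) xs = card ((?S \<times> ?S - Id) \<union> (?T \<times> ?T - Id))"
    using S by simp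
  also have "\<dots> = card (?S \<times> ?S - Id) + card (?T \<times> ?T - Id)"
    by (rule card_Un_disjoint) auto
  also have "\<dots> = card ?S * (card ?S - 1) + card ?T * (card ?T - 1)"
    using card_Times_self_minus_Id[of ?S] card_Times_self_minus_Id[of ?T] by simp
  finally have "2 * ((card ?S + card ?T - 1)\<^sup>2 div 4) \<le> order_discrepancy (set xs) (rev xs) xs"
    using double_quarter_square_le_two_cliques by simp
  moreover have "card ?S + card ?T = length xs"
    using card_Int_Diff[of "set xs" S] distinct_card[OF assms] by simp
  ultimately show ?thesis
    by simp
qed


section \<open>Affine permutations\<close>

definition affine_perm :: "int \<Rightarrow> (int \<Rightarrow> int) \<Rightarrow> bool" where
  "affine_perm N w \<longleftrightarrow> bij w \<and> (\<forall>z. w (z + N) = w z + N)"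

lemma affine_perm_eq_iff: "affine_perm N w \<Longrightarrow> w y = w z \<longleftrightarrow> y = z"
  by (auto simp: affine_perm_def bij_def inj_eq)

lemma affine_perm_comp: "affine_perm N v \<Longrightarrow> affine_perm N w \<Longrightarrow> affine_perm N (v \<circ> w)"
  by (auto simp: affine_perm_def bij_comp)

lemma shift_commute_multiple:
  fixes w :: "int \<Rightarrow> int"
  assumes "\<And>z. w (z + N) = w z + N"
  shows "w (z + k * N) = w z + k * N"
proof (induction k rule: int_induct[where k = 0])
  case (step1 k)
  then show ?case
    using assms[of "z + k * N"] by (simp add: algebra_simps)
next
  case (step2 k)
  then show ?case
    using assms[of "z + (k - 1) * N"] by (simp add: algebra_simps)
qed simp

lemma shift_commute_mod_eq:
  fixes w :: "int \<Rightarrow> int"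
  assumes "\<And>z. w (z + N) = w z + N"
  shows "w (z mod N) mod N = w z mod N"
proof -
  have "w z = w (z mod N) + z div N * N"
    using shift_commute_multiple[of w N, OF assms, of "z mod N" "z div N"] by simp
  then show ?thesis by simp
qed

lemma affine_perm_shift: "affine_perm N w \<Longrightarrow> w (z + k * N) = w z + k * N"
  by (simp add: affine_perm_def shift_commute_multiple)

lemma mod_eq_iff_ex_shift:
  fixes y z :: int
  shows "y mod N = z mod N \<longleftrightarrow> (\<exists>k. z = y + k * N)"
  by (metis mod_eqE mod_mult_self1 mult.commute)

lemma affine_perm_mod_eq_iff:
  assumes "affine_perm N w"
  shows "w y mod N = w z mod N \<longleftrightarrow> y mod N = z mod N"
  unfolding mod_eq_iff_ex_shift
  by (simp add: affine_perm_eq_iff[OF assms] flip: affine_perm_shift[OF assms])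

lemma affine_permI:
  assumes N: "0 < N" and shift: "\<And>z. w (z + N) = w z + N"
    and inj: "inj_on (\<lambda>z. w z mod N) {0..<N}"
  shows "affine_perm N w"
proof -
  note shift_multiple = shift_commute_multiple[of w N, OF shift]
  have "inj w"
  proof (rule injI)
    fix y z assume eq: "w y = w z"
    have "w (y mod N) mod N = w (z mod N) mod N"
      unfolding shift_commute_mod_eq[of w N, OF shift] eq ..
    then have "y mod N = z mod N"
      using inj_onD[OF inj, of "y mod N" "z mod N"] N by simp
    then obtain k where "z = y + k * N"
      unfolding mod_eq_iff_ex_shift by blast
    then show "y = z"
      using eq N by (simp add: shift_multiple)
  qed
  moreover have "surj w"
    unfolding surj_def
  proof
    fix y
    have "(\<lambda>z. w z mod N) ` {0..<N} = {0..<N}"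
      using N inj by (intro endo_inj_surj) auto
    then obtain z where "y mod N = w z mod N"
      using N by (metis (no_types, lifting) atLeastLessThan_iff imageE pos_mod_bound pos_mod_sign)
    then obtain k where "w z = y + k * N"
      unfolding mod_eq_iff_ex_shift by blast
    then have "y = w (z + (- k) * N)"
      unfolding shift_multiple by simp
    then show "\<exists>z. y = w z" ..
  qed
  ultimately show ?thesis
    using shift by (simp add: affine_perm_def bij_def)
qed

definition simple_reflection :: "int \<Rightarrow> int \<Rightarrow> int \<Rightarrow> int" where
  "simple_reflection N t z =
    (if z mod N = t mod N then z + 1 else if z mod N = (t + 1) mod N then z - 1 else z)"

lemma mod_add_one_neq:
  fixes z :: int
  assumes "2 \<le> N"
  shows "(z + 1) mod N \<noteq> z mod N"
  using assms by (auto simp: mod_eq_dvd_iff zdvd_not_zless)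

lemma simple_reflection_involution:
  assumes "2 \<le> N"
  shows "simple_reflection N t (simple_reflection N t z) = z"
proof -
  have up: "(z + 1) mod N = (t + 1) mod N" if "z mod N = t mod N"
    using that by (rule mod_add_cong) simp
  have down: "(z - 1) mod N = t mod N" if "z mod N = (t + 1) mod N"
    using mod_diff_cong[OF that refl, of 1] by simp
  show ?thesis
    using up down mod_add_one_neq[OF assms, of t] by (simp add: simple_reflection_def)
qed

lemma affine_perm_simple_reflection:
  assumes "2 \<le> N"
  shows "affine_perm N (simple_reflection N t)"
proof -
  have "bij (simple_reflection N t)"
    using simple_reflection_involution[OF assms] by (intro involuntory_imp_bij)
  then show ?thesis
    by (simp add: affine_perm_def simple_reflection_def)
qed

lemma affine_perm_increasing_imp_shift:
  assumes w: "affine_perm N w" and N: "0 < N" and inc: "\<And>z. w z < w (z + 1)"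
  shows "w = (\<lambda>z. z + w 0)"
proof
  fix z
  have grow: "w y + int k \<le> w (y + int k)" for y k
  proof (induction k)
    case (Suc k)
    then show ?case
      using inc[of "y + int k"] by (simp add: algebra_simps)
  qed simp
  have "w (z mod N) = z mod N + w 0"
  proof (rule antisym)
    have "w (z mod N) + (N - z mod N) \<le> w N"
      using grow[of "z mod N" "nat (N - z mod N)"] pos_mod_bound[OF N, of z] by simp
    then show "w (z mod N) \<le> z mod N + w 0"
      using affine_perm_shift[OF w, of 0 1] by simp
    show "z mod N + w 0 \<le> w (z mod N)"
      using grow[of 0 "nat (z mod N)"] N by simp
  qed
  then show "w z = z + w 0"
    using affine_perm_shift[OF w, of "z mod N" "z div N"] by simp
qed


section \<open>Crossing numbers\<close>

text \<open>
  The signed number of translates \<open>j + kN\<close> that \<open>i\<close> overtakes when every \<open>z\<close> moves to \<open>w z\<close>. Hence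
  \<open>crossing_number\<close> is twice the Coxeter length of \<open>w\<close>, as it counts every unordered pair twice.
\<close>

definition crossing :: "int \<Rightarrow> (int \<Rightarrow> int) \<Rightarrow> int \<Rightarrow> int \<Rightarrow> int" where
  "crossing N w i j = (w i - w j) div N - (i - j) div N"

definition crossing_number :: "int \<Rightarrow> (int \<Rightarrow> int) \<Rightarrow> int" where
  "crossing_number N w = (\<Sum>i\<in>{0..<N}. \<Sum>j\<in>{0..<N}. \<bar>crossing N w i j\<bar>)"

lemma crossing_number_nonneg: "0 \<le> crossing_number N w"
  unfolding crossing_number_def by (intro sum_nonneg) simp

lemma crossing_shift:
  assumes "affine_perm N w" "0 < N"
  shows "crossing N w (i + k * N) j = crossing N w i j"
    and "crossing N w i (j + k * N) = crossing N w i j"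
proof -
  have "w i + k * N - w j = w i - w j + k * N" "i + k * N - j = i - j + k * N"
    "w i - (w j + k * N) = w i - w j + (- k) * N" "i - (j + k * N) = i - j + (- k) * N"
    by simp_all
  then show "crossing N w (i + k * N) j = crossing N w i j"
    "crossing N w i (j + k * N) = crossing N w i j"
    using assms(2) unfolding crossing_def affine_perm_shift[OF assms(1)]
    by (simp_all only: div_mult_self1)
qed

lemma sum_shift_window:
  fixes f :: "int \<Rightarrow> 'a :: comm_monoid_add"
  assumes "0 < N" and periodic: "\<And>z k. f (z + k * N) = f z"
  shows "sum f {t..<t + N} = sum f {0..<N}"
proof (rule sum.reindex_bij_witness[where i = "\<lambda>z. t + (z - t) mod N" and j = "\<lambda>z. z mod N"])
  fix z
  show "f (z mod N) = f z"
    using periodic[of "z mod N" "z div N"] by simp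
qed (use assms in \<open>auto simp: mod_simps\<close>)

lemma crossing_number_window:
  assumes "affine_perm N w" "0 < N"
  shows "crossing_number N w = (\<Sum>i\<in>{t..<t + N}. \<Sum>j\<in>{t..<t + N}. \<bar>crossing N w i j\<bar>)"
  unfolding crossing_number_def using assms by (simp add: sum_shift_window crossing_shift)

lemma crossing_in_window:
  assumes "i \<in> {t..<t + N}" "j \<in> {t..<t + N}"
  shows "crossing N w i j = (w i - w j) div N + of_bool (i < j)"
proof -
  have "(i - j) div N = - of_bool (i < j)"
  proof (cases "i < j")
    case True
    then show ?thesis
      using assms by (intro int_div_pos_eq[where r = "i - j + N"]) auto
  next
    case False
    then show ?thesis
      using assms by (simp add: div_pos_pos_trivial)
  qed
  then show ?thesis
    by (simp add: crossing_def)
qed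

lemma simple_reflection_in_window:
  assumes "2 \<le> N" "z \<in> {t..<t + N}"
  shows "simple_reflection N t z = (if z = t then t + 1 else if z = t + 1 then t else z)"
proof -
  have "z mod N = y mod N \<longleftrightarrow> z = y" if "y \<in> {t..<t + N}" for y
    using that assms dvd_imp_le_int[of "z - y" N] by (cases "z = y") (auto simp: mod_eq_dvd_iff)
  then show ?thesis
    using assms(1) by (simp add: simple_reflection_def)
qed

lemma bij_betw_simple_reflection_window:
  assumes "2 \<le> N"
  shows "bij_betw (simple_reflection N t) {t..<t + N} {t..<t + N}"
  by (rule bij_betw_byWitness[where f' = "simple_reflection N t"])
    (use assms in \<open>auto simp: simple_reflection_involution simple_reflection_in_window\<close>)

lemma abs_crossing_reflected_order:
  assumes "2 \<le> N" "w (t + 1) < w t" "i \<in> {t..<t + N}" "j \<in> {t..<t + N}"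
  shows "\<bar>(w i - w j) div N + of_bool (simple_reflection N t i < simple_reflection N t j)\<bar>
    = \<bar>crossing N w i j\<bar> - of_bool ((i, j) \<in> {(t, t + 1), (t + 1, t)})"
proof -
  have "0 \<le> (w t - w (t + 1)) div N" "(w (t + 1) - w t) div N < 0"
    using assms(1,2) by (simp_all add: pos_imp_zdiv_nonneg_iff pos_imp_zdiv_neg_iff)
  moreover have "simple_reflection N t i < simple_reflection N t j
      \<longleftrightarrow> (if (i, j) \<in> {(t, t + 1), (t + 1, t)} then j < i else i < j)"
    using assms by (auto simp: simple_reflection_in_window)
  ultimately show ?thesis
    using assms(3,4) by (auto simp: crossing_in_window)
qed

lemma crossing_number_descent:
  assumes w: "affine_perm N w" and N: "2 \<le> N" and descent: "w (t + 1) < w t"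
  shows "crossing_number N (w \<circ> simple_reflection N t) = crossing_number N w - 2"
proof -
  let ?W = "{t..<t + N}" and ?s = "simple_reflection N t"
  let ?swapped = "{(t, t + 1), (t + 1, t)}"
  note reindex = sum.reindex_bij_betw[OF bij_betw_simple_reflection_window[OF N, of t]]
  have "crossing_number N (w \<circ> ?s) = (\<Sum>i\<in>?W. \<Sum>j\<in>?W. \<bar>crossing N (w \<circ> ?s) i j\<bar>)"
    using w N by (intro crossing_number_window affine_perm_comp affine_perm_simple_reflection) auto
  also have "\<dots> = (\<Sum>i\<in>?W. \<Sum>j\<in>?W. \<bar>(w (?s i) - w (?s j)) div N + of_bool (?s (?s i) < ?s (?s j))\<bar>)"
    using N by (intro sum.cong refl) (simp add: crossing_in_window simple_reflection_involution)
  also have "\<dots> = (\<Sum>i\<in>?W. \<Sum>j\<in>?W. \<bar>(w i - w j) div N + of_bool (?s i < ?s j)\<bar>)"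
    by (subst (1 2) reindex[symmetric]) simp
  also have "\<dots> = (\<Sum>i\<in>?W. \<Sum>j\<in>?W. \<bar>crossing N w i j\<bar> - of_bool ((i, j) \<in> ?swapped))"
    using abs_crossing_reflected_order[OF N, of w t] descent by (intro sum.cong refl)
  also have "\<dots> = crossing_number N w - (\<Sum>i\<in>?W. \<Sum>j\<in>?W. of_bool ((i, j) \<in> ?swapped))"
    using N by (simp add: sum_subtractf crossing_number_window[OF w, of t] del: insert_iff)
  also have "(\<Sum>i\<in>?W. \<Sum>j\<in>?W. of_bool ((i, j) \<in> ?swapped)) = (\<Sum>e\<in>?W \<times> ?W. of_bool (e \<in> ?swapped))"
    by (simp only: sum.cartesian_product split_def prod.collapse)
  also have "(\<Sum>e\<in>?W \<times> ?W. of_bool (e \<in> ?swapped)) = (2 :: int)"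
  proof -
    have "(?W \<times> ?W) \<inter> ?swapped = ?swapped"
      using N by auto
    moreover have "card ?swapped = 2"
      by simp
    ultimately show ?thesis
      by (simp add: sum_of_bool_eq del: insert_iff)
  qed
  finally show ?thesis .
qed


section \<open>Averaging over windows\<close>

text \<open>The representative of \<open>x z\<close> modulo \<open>N\<close> that is at least \<open>t\<close> and less than \<open>t + N\<close> away from \<open>z\<close>.\<close>

definition window_lift :: "int \<Rightarrow> (int \<Rightarrow> int) \<Rightarrow> int \<Rightarrow> int \<Rightarrow> int" where
  "window_lift N x t z = z + t + (x z - z - t) mod N"

lemma window_lift_mod: "window_lift N x t z mod N = x z mod N"
  by (simp add: window_lift_def mod_simps)

lemma affine_perm_window_lift:
  assumes "0 < N" "\<And>z. x (z + N) = x z" "inj_on (\<lambda>z. x z mod N) {0..<N}"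
  shows "affine_perm N (window_lift N x t)"
proof (rule affine_permI)
  fix z
  have "(x z - (z + N) - t) mod N = (x z - z - t - N) mod N"
    by (simp add: algebra_simps)
  then show "window_lift N x t (z + N) = window_lift N x t z + N"
    by (simp add: window_lift_def assms(2))
qed (use assms in \<open>simp_all add: window_lift_mod\<close>)

lemma sum_abs_eq_abs_sum_if_same_sign:
  fixes f :: "'a \<Rightarrow> 'b :: linordered_idom"
  assumes "(\<forall>t\<in>T. 0 \<le> f t) \<or> (\<forall>t\<in>T. f t \<le> 0)"
  shows "(\<Sum>t\<in>T. \<bar>f t\<bar>) = \<bar>\<Sum>t\<in>T. f t\<bar>"
  using assms
proof
  assume "\<forall>t\<in>T. f t \<le> 0"
  then show ?thesis by (simp add: sum_nonpos sum_negf)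
qed (simp add: sum_nonneg)

lemma nonneg_if_close_multiple:
  fixes N c d :: int
  assumes "\<bar>N * c - d\<bar> < N" "0 \<le> d"
  shows "0 \<le> c"
proof -
  have "0 < N" "N * (- 1) < N * c"
    using assms by linarith+
  then have "- 1 < c"
    by (simp only: mult_less_cancel_left_pos)
  then show ?thesis by simp
qed

lemma bij_betw_minus_mod:
  fixes u :: int
  assumes "0 < N"
  shows "bij_betw (\<lambda>t. (u - t) mod N) {0..<N} {0..<N}"
  by (rule bij_betw_byWitness[where f' = "\<lambda>t. (u - t) mod N"])
    (use assms in \<open>auto simp: mod_simps\<close>)

lemma multiple_crossing_window_lift:
  "N * crossing N (window_lift N x t) i j
    = (x i - i - t) mod N - (x j - j - t) mod N + ((i - j) mod N - (x i - x j) mod N)"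
proof -
  have "(window_lift N x t i - window_lift N x t j) mod N = (x i - x j) mod N"
    by (intro mod_diff_cong window_lift_mod)
  then show ?thesis
    unfolding crossing_def right_diff_distrib minus_mod_eq_mult_div[symmetric]
    by (simp add: window_lift_def)
qed

text \<open>
  For every \<open>t\<close>, the crossing of \<open>i\<close> and \<open>j\<close> times \<open>N\<close> is within \<open>N\<close> of the same number, hence it keeps
  its sign and the absolute values can be pulled out of the sum.
\<close>

lemma sum_crossing_window_lift:
  assumes N: "0 < N"
  shows "(\<Sum>t\<in>{0..<N}. \<bar>crossing N (window_lift N x t) i j\<bar>) = \<bar>(x i - x j) mod N - (i - j) mod N\<bar>"
proof -
  let ?c = "\<lambda>t. crossing N (window_lift N x t) i j"
  define d where "d = (i - j) mod N - (x i - x j) mod N"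
  define A where "A k t = (x k - k - t) mod N" for k t
  have scaled: "N * ?c t = A i t - A j t + d" for t
    by (simp add: multiple_crossing_window_lift A_def d_def)
  have "(\<Sum>t\<in>{0..<N}. A k t) = (\<Sum>t\<in>{0..<N}. t)" for k
    unfolding A_def using sum.reindex_bij_betw[OF bij_betw_minus_mod[OF N], of "\<lambda>t. t"] .
  then have "N * (\<Sum>t\<in>{0..<N}. ?c t) = N * d"
    using N by (simp add: sum_distrib_left scaled sum.distrib sum_subtractf)
  then have total: "(\<Sum>t\<in>{0..<N}. ?c t) = d"
    using N by simp
  have close: "\<bar>N * ?c t - d\<bar> < N" for t
    using N pos_mod_bound[OF N, of "x i - i - t"] pos_mod_bound[OF N, of "x j - j - t"]
      pos_mod_sign[OF N, of "x i - i - t"] pos_mod_sign[OF N, of "x j - j - t"]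
    unfolding scaled A_def by linarith
  have "(\<forall>t\<in>{0..<N}. 0 \<le> ?c t) \<or> (\<forall>t\<in>{0..<N}. ?c t \<le> 0)"
  proof (cases "0 \<le> d")
    case True
    then show ?thesis
      using nonneg_if_close_multiple[OF close] by blast
  next
    case False
    have "\<bar>N * (- ?c t) - (- d)\<bar> < N" for t
      using close[of t] by (simp add: abs_minus_commute)
    then have "0 \<le> - ?c t" for t
      by (rule nonneg_if_close_multiple) (use False in simp)
    then show ?thesis by simp
  qed
  then show ?thesis
    using total d_def sum_abs_eq_abs_sum_if_same_sign[of "{0..<N}" ?c] by simp
qed

lemma sum_abs_twice_minus_eq_quarter_square:
  "(\<Sum>k = 1..<n. \<bar>2 * int k - int n\<bar>) = 2 * int ((n - 1)\<^sup>2 div 4)"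
proof (induction n rule: induct_nat_012)
  case (ge2 n)
  show ?case
  proof (cases n)
    case (Suc m)
    have "(\<Sum>k = 1..<Suc (Suc n). \<bar>2 * int k - int (Suc (Suc n))\<bar>)
        = int n + (\<Sum>k = Suc 1..<Suc (Suc n). \<bar>2 * int k - int (Suc (Suc n))\<bar>)"
      by (subst sum.atLeast_Suc_lessThan) auto
    also have "(\<Sum>k = Suc 1..<Suc (Suc n). \<bar>2 * int k - int (Suc (Suc n))\<bar>)
        = (\<Sum>k = 1..<Suc n. \<bar>2 * int k - int n\<bar>)"
      by (subst sum.shift_bounds_Suc_ivl) (simp add: algebra_simps)
    also have "\<dots> = 2 * int ((n - 1)\<^sup>2 div 4) + int n"
      using ge2.IH(1) Suc by (simp add: sum.atLeastLessThan_Suc)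
    also have "int n + (2 * int ((n - 1)\<^sup>2 div 4) + int n) = 2 * int (((n - 1)\<^sup>2 + n * 4) div 4)"
      by simp
    also have "(n - 1)\<^sup>2 + n * 4 = (Suc (Suc n) - 1)\<^sup>2"
      by (simp add: Suc power2_eq_square algebra_simps)
    finally show ?thesis .
  qed (simp add: numeral_2_eq_2)
qed simp_all

lemma sum_abs_diff_residues_le:
  fixes p q :: "'a \<Rightarrow> int"
  assumes "bij_betw p B {1..<int n}" "bij_betw q B {1..<int n}"
  shows "(\<Sum>b\<in>B. \<bar>p b - q b\<bar>) \<le> 2 * int ((n - 1)\<^sup>2 div 4)"
proof -
  have total: "(\<Sum>b\<in>B. \<bar>2 * r b - int n\<bar>) = 2 * int ((n - 1)\<^sup>2 div 4)"
    if "bij_betw r B {1..<int n}" for r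
  proof -
    have "(\<Sum>b\<in>B. \<bar>2 * r b - int n\<bar>) = (\<Sum>k\<in>{1..<int n}. \<bar>2 * k - int n\<bar>)"
      using sum.reindex_bij_betw[OF that, of "\<lambda>k. \<bar>2 * k - int n\<bar>"] .
    also have "{1..<int n} = int ` {1..<n}"
      by (simp add: image_int_atLeastLessThan)
    also have "(\<Sum>k\<in>int ` {1..<n}. \<bar>2 * k - int n\<bar>) = (\<Sum>k = 1..<n. \<bar>2 * int k - int n\<bar>)"
      by (simp add: sum.reindex)
    finally show ?thesis
      using sum_abs_twice_minus_eq_quarter_square by simp
  qed
  have "2 * \<bar>p b - q b\<bar> \<le> \<bar>2 * p b - int n\<bar> + \<bar>2 * q b - int n\<bar>" for b
    by arith
  then have "2 * (\<Sum>b\<in>B. \<bar>p b - q b\<bar>) \<le> (\<Sum>b\<in>B. \<bar>2 * p b - int n\<bar> + \<bar>2 * q b - int n\<bar>)"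
    unfolding sum_distrib_left by (rule sum_mono)
  then show ?thesis
    by (simp add: sum.distrib total assms)
qed

lemma bij_betw_diff_mod:
  fixes x :: "'a \<Rightarrow> int"
  assumes inj: "inj_on (\<lambda>b. x b mod N) A" and a: "a \<in> A"
    and card: "int (card A) = N" and N: "0 < N"
  shows "bij_betw (\<lambda>b. (x a - x b) mod N) (A - {a}) {1..<N}"
proof -
  let ?f = "\<lambda>b. (x a - x b) mod N"
  have inj_f: "inj_on ?f A"
  proof (rule inj_onI)
    fix b c assume "b \<in> A" "c \<in> A" "?f b = ?f c"
    then have "x c mod N = x b mod N"
      by (simp add: mod_eq_dvd_iff)
    then show "b = c"
      using inj_onD[OF inj] \<open>b \<in> A\<close> \<open>c \<in> A\<close> by metis
  qed
  have "?f ` (A - {a}) \<subseteq> {1..<N}"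
  proof (rule image_subsetI)
    fix b assume "b \<in> A - {a}"
    then have "?f b \<noteq> 0"
      using inj_onD[OF inj_f, of b a] a by auto
    then show "?f b \<in> {1..<N}"
      using pos_mod_sign[OF N, of "x a - x b"] pos_mod_bound[OF N, of "x a - x b"] by simp
  qed
  moreover have "card (?f ` (A - {a})) = card {1..<N}"
    using card_image[OF inj_on_subset[OF inj_f, of "A - {a}"]] a card by (auto simp: card_Diff_singleton)
  ultimately have "?f ` (A - {a}) = {1..<N}"
    by (intro card_subset_eq) auto
  then show ?thesis
    using inj_on_subset[OF inj_f, of "A - {a}"] by (auto simp: bij_betw_def)
qed

lemma exists_window_lift_crossing_number_le:
  assumes n: "0 < n" and inj: "inj_on (\<lambda>z. x z mod int n) {0..<int n}"
  obtains t where "crossing_number (int n) (window_lift (int n) x t) \<le> 2 * int ((n - 1)\<^sup>2 div 4)"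
proof -
  let ?N = "int n" and ?F = "2 * int ((n - 1)\<^sup>2 div 4)"
  have row: "(\<Sum>j\<in>{0..<?N}. \<bar>(x i - x j) mod ?N - (i - j) mod ?N\<bar>) \<le> ?F" if i: "i \<in> {0..<?N}" for i
  proof -
    have "bij_betw (\<lambda>j. (x i - x j) mod ?N) ({0..<?N} - {i}) {1..<?N}"
      using inj i n by (intro bij_betw_diff_mod) auto
    moreover have "bij_betw (\<lambda>j. (i - j) mod ?N) ({0..<?N} - {i}) {1..<?N}"
      using i n by (intro bij_betw_diff_mod[where x = "\<lambda>j. j"]) (auto simp: inj_on_def)
    ultimately have "(\<Sum>j\<in>{0..<?N} - {i}. \<bar>(x i - x j) mod ?N - (i - j) mod ?N\<bar>) \<le> ?F"
      by (rule sum_abs_diff_residues_le)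
    then show ?thesis
      using i by (subst sum.remove[of _ i]) auto
  qed
  have "(\<Sum>t\<in>{0..<?N}. crossing_number ?N (window_lift ?N x t))
      = (\<Sum>i\<in>{0..<?N}. \<Sum>j\<in>{0..<?N}. \<Sum>t\<in>{0..<?N}. \<bar>crossing ?N (window_lift ?N x t) i j\<bar>)"
    unfolding crossing_number_def by (subst sum.swap, subst (2) sum.swap) (rule refl)
  also have "\<dots> = (\<Sum>i\<in>{0..<?N}. \<Sum>j\<in>{0..<?N}. \<bar>(x i - x j) mod ?N - (i - j) mod ?N\<bar>)"
    using n by (simp add: sum_crossing_window_lift)
  also have "\<dots> \<le> (\<Sum>t\<in>{0..<?N}. ?F)"
    by (rule sum_mono) (rule row)
  finally have total: "(\<Sum>t\<in>{0..<?N}. crossing_number ?N (window_lift ?N x t)) \<le> (\<Sum>t\<in>{0..<?N}. ?F)" .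
  have "\<exists>t. crossing_number ?N (window_lift ?N x t) \<le> ?F"
  proof (rule ccontr)
    assume "\<nexists>t. crossing_number ?N (window_lift ?N x t) \<le> ?F"
    then have "(\<Sum>t\<in>{0..<?N}. ?F) < (\<Sum>t\<in>{0..<?N}. crossing_number ?N (window_lift ?N x t))"
      using n by (intro sum_strict_mono) (auto simp: not_le)
    then show False
      using total by simp
  qed
  then show thesis
    using that by blast
qed


section \<open>Labelings described by affine permutations\<close>

definition residue_label :: "nat \<Rightarrow> int \<Rightarrow> nat" where
  "residue_label n z = Suc (nat ((z - 1) mod int n))"

lemma residue_label_eq_iff:
  assumes "0 < n"
  shows "residue_label n y = residue_label n z \<longleftrightarrow> y mod int n = z mod int n"
proof -
  have "residue_label n y = residue_label n z \<longleftrightarrow> (y - 1) mod int n = (z - 1) mod int n"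
    using assms by (simp add: residue_label_def eq_nat_nat_iff)
  then show ?thesis
    by (simp add: mod_eq_dvd_iff)
qed

lemma residue_label_in: "0 < n \<Longrightarrow> residue_label n z \<in> {1..n}"
  by (simp add: residue_label_def Suc_le_eq nat_less_iff)

lemma residue_label_of_nat: "a \<in> {1..n} \<Longrightarrow> residue_label n (int a) = a"
  by (cases a) (auto simp: residue_label_def)

definition labeling_of :: "nat \<Rightarrow> (int \<Rightarrow> int) \<Rightarrow> nat list" where
  "labeling_of n w = map (\<lambda>p. residue_label n (w (int p))) [0..<n]"

lemma length_labeling_of [simp]: "length (labeling_of n w) = n"
  by (simp add: labeling_of_def)

lemma nth_labeling_of [simp]: "p < n \<Longrightarrow> labeling_of n w ! p = residue_label n (w (int p))"
  by (simp add: labeling_of_def)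

lemma labeling_of_in_labelings:
  assumes w: "affine_perm (int n) w" and n: "0 < n"
  shows "labeling_of n w \<in> labelings n"
proof -
  have "distinct (labeling_of n w)"
    using n by (auto simp: distinct_conv_nth residue_label_eq_iff affine_perm_mod_eq_iff[OF w])
  moreover have "set (labeling_of n w) \<subseteq> {1..n}"
    using residue_label_in[OF n] by (auto simp: labeling_of_def simp del: atLeastAtMost_iff)
  ultimately have "set (labeling_of n w) = {1..n}"
    by (intro card_subset_eq) (simp_all add: distinct_card)
  then show ?thesis
    using \<open>distinct (labeling_of n w)\<close> by (simp add: labelings_def)
qed

lemma labeling_of_simple_reflection:
  assumes w: "affine_perm (int n) w" and n: "2 \<le> n" and i: "i < n"
  shows "labeling_of n (w \<circ> simple_reflection (int n) (int i))
    = swap_labels (labeling_of n w) i ((i + 1) mod n)"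
proof (rule nth_equalityI)
  let ?j = "(i + 1) mod n"
  have j: "?j < n" "(int i + 1) mod int n = int ?j"
    using n by (simp_all add: zmod_int add.commute)
  have "i \<noteq> ?j"
    using i n by (auto simp: mod_Suc)
  fix p assume "p < length (labeling_of n (w \<circ> simple_reflection (int n) (int i)))"
  then have p: "p < n" by simp
  have "simple_reflection (int n) (int i) (int p)
      = (if p = i then int p + 1 else if p = ?j then int p - 1 else int p)"
    using p i j by (simp add: simple_reflection_def)
  moreover have "(int ?j - 1) mod int n = int i"
    unfolding j(2)[symmetric] using i by (simp add: mod_diff_left_eq)
  ultimately have "simple_reflection (int n) (int i) (int p) mod int n
      = int (if p = ?j then i else if p = i then ?j else p)"
    using p j \<open>i \<noteq> ?j\<close> by auto
  then show "labeling_of n (w \<circ> simple_reflection (int n) (int i)) ! p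
      = swap_labels (labeling_of n w) i ?j ! p"
    using p i j n
    by (auto simp: nth_swap_labels residue_label_eq_iff affine_perm_mod_eq_iff[OF w])
qed simp

lemma labeling_of_shift:
  assumes "0 < n"
  shows "labeling_of n (\<lambda>z. z + c) = rotate (nat ((c - 1) mod int n)) [1..<Suc n]"
proof (rule nth_equalityI)
  let ?k = "nat ((c - 1) mod int n)"
  fix p assume "p < length (labeling_of n (\<lambda>z. z + c))"
  then have p: "p < n" by simp
  have "(int p + c - 1) mod int n = int ((?k + p) mod n)"
    using assms by (simp add: zmod_int mod_simps algebra_simps)
  then show "labeling_of n (\<lambda>z. z + c) ! p = rotate ?k [1..<Suc n] ! p"
    using p assms by (simp add: nth_rotate residue_label_def del: upt_Suc)
qed simp

lemma exists_labeling_of_crossing_number_le: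
  assumes n: "0 < n" and xs: "xs \<in> labelings n"
  obtains w where "affine_perm (int n) w" "labeling_of n w = xs"
    "crossing_number (int n) w \<le> 2 * int ((n - 1)\<^sup>2 div 4)"
proof -
  define x where "x z = int (xs ! nat (z mod int n))" for z
  have nth: "xs ! p \<in> {1..n}" if "p < n" for p
    using that nth_mem[of p xs] xs length_labeling[OF xs] by (auto simp: labelings_def)
  have inj: "inj_on (\<lambda>z. x z mod int n) {0..<int n}"
  proof (rule inj_onI)
    fix y z assume yz: "y \<in> {0..<int n}" "z \<in> {0..<int n}" "x y mod int n = x z mod int n"
    then have "xs ! nat y = xs ! nat z"
      using n nth[of "nat y"] nth[of "nat z"] residue_label_eq_iff[of n "x y" "x z"]
      by (simp add: x_def residue_label_of_nat nat_less_iff)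
    then have "nat y = nat z"
      using xs yz length_labeling[OF xs] by (simp add: labelings_def nth_eq_iff_index_eq nat_less_iff)
    then show "y = z"
      using yz by (simp add: eq_nat_nat_iff)
  qed
  then obtain t where t: "crossing_number (int n) (window_lift (int n) x t) \<le> 2 * int ((n - 1)\<^sup>2 div 4)"
    using exists_window_lift_crossing_number_le[OF n] by blast
  show thesis
  proof (rule that[OF _ _ t])
    show "affine_perm (int n) (window_lift (int n) x t)"
      using n inj by (intro affine_perm_window_lift) (simp_all add: x_def)
    show "labeling_of n (window_lift (int n) x t) = xs"
    proof (rule nth_equalityI)
      fix p assume "p < length (labeling_of n (window_lift (int n) x t))"
      then have p: "p < n" by simp
      have "residue_label n (window_lift (int n) x t (int p)) = residue_label n (int (xs ! p))"
        using n p by (simp add: residue_label_eq_iff window_lift_mod x_def)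
      then show "labeling_of n (window_lift (int n) x t) ! p = xs ! p"
        using p nth[OF p] by (simp add: residue_label_of_nat)
    qed (simp add: length_labeling[OF xs])
  qed
qed

lemma affine_perm_descentE:
  assumes w: "affine_perm (int n) w" and n: "0 < n" and "\<not> (\<forall>z. w z < w (z + 1))"
  obtains i where "i < n" "2 \<le> n" "w (int i + 1) < w (int i)"
proof -
  obtain z where "w (z + 1) \<le> w z"
    using assms(3) by (auto simp: not_less)
  then have z: "w (z + 1) < w z"
    using affine_perm_eq_iff[OF w, of "z + 1" z] by simp
  define i where "i = nat (z mod int n)"
  have i: "int i = z + (- (z div int n)) * int n"
    using n minus_div_mult_eq_mod[of z "int n"] by (simp add: i_def)
  have "w (int i + 1) = w (z + 1) + (- (z div int n)) * int n"
    unfolding i using affine_perm_shift[OF w, of "z + 1" "- (z div int n)"] by (simp add: algebra_simps)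
  then have "w (int i + 1) < w (int i)"
    unfolding i affine_perm_shift[OF w] using z by simp
  moreover have "2 \<le> n"
  proof (rule ccontr)
    assume "\<not> 2 \<le> n"
    then have "w (z + 1) = w z + 1"
      using n affine_perm_shift[OF w, of z 1] by (simp add: not_le less_2_cases_iff)
    then show False using z by simp
  qed
  moreover have "i < n"
    using n by (simp add: i_def nat_less_iff)
  ultimately show thesis using that by blast
qed

lemma exists_adjacent_swaps_to_trivial:
  assumes n: "0 < n" and w: "affine_perm (int n) w"
  shows "\<exists>k. 2 * int k \<le> crossing_number (int n) w \<and>
    (rotation_rel n `` {labeling_of n w}, trivial_cyclic_perm n) \<in> adjacent_swap n ^^ k"
  using w
proof (induction w rule: measure_induct_rule[where f = "\<lambda>w. nat (crossing_number (int n) w)"])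
  case (less w)
  show ?case
  proof (cases "\<forall>z. w z < w (z + 1)")
    case True
    then obtain c where shift: "w = (\<lambda>z. z + c)"
      using affine_perm_increasing_imp_shift[OF less.prems] n of_nat_0_less_iff by blast
    have "rotation_rel n `` {labeling_of n w} = trivial_cyclic_perm n"
      unfolding shift labeling_of_shift[OF n] by (rule rotation_class_upt_eq)
    then show ?thesis
      by (intro exI[of _ 0]) (simp add: crossing_number_nonneg)
  next
    case False
    then obtain i where i: "i < n" "2 \<le> n" and descent: "w (int i + 1) < w (int i)"
      using affine_perm_descentE[OF less.prems n] by blast
    let ?v = "w \<circ> simple_reflection (int n) (int i)"
    have v: "affine_perm (int n) ?v"
      using less.prems i by (intro affine_perm_comp affine_perm_simple_reflection) auto
    have drop: "crossing_number (int n) ?v = crossing_number (int n) w - 2"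
      using crossing_number_descent[OF less.prems _ descent] i by simp
    then have "nat (crossing_number (int n) ?v) < nat (crossing_number (int n) w)"
      using crossing_number_nonneg[of "int n" ?v] by simp
    from less.IH[OF this v] obtain k where k: "2 * int k \<le> crossing_number (int n) ?v"
      "(rotation_rel n `` {labeling_of n ?v}, trivial_cyclic_perm n) \<in> adjacent_swap n ^^ k"
      by blast
    have "(rotation_rel n `` {labeling_of n w}, rotation_rel n `` {labeling_of n ?v}) \<in> adjacent_swap n"
      using adjacent_swapI[OF labeling_of_in_labelings[OF less.prems n] i]
      by (simp add: labeling_of_simple_reflection[OF less.prems i(2,1)])
    from relpow_Suc_I2[OF this k(2)] show ?thesis
      using k(1) drop by (intro exI[of _ "Suc k"]) simp
  qed
qed


section \<open>The diameter\<close>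

lemma swap_distance_trivial_le:
  assumes n: "0 < n" and P: "P \<in> cyclic_perms n"
  shows "swap_distance n P (trivial_cyclic_perm n) \<le> enat ((n - 1)\<^sup>2 div 4)"
proof -
  obtain xs where xs: "xs \<in> labelings n" "P = rotation_rel n `` {xs}"
    using P unfolding cyclic_perms_def by (auto elim: quotientE)
  obtain w where w: "affine_perm (int n) w" "labeling_of n w = xs"
    and cost: "crossing_number (int n) w \<le> 2 * int ((n - 1)\<^sup>2 div 4)"
    using exists_labeling_of_crossing_number_le[OF n xs(1)] .
  obtain k where "2 * int k \<le> crossing_number (int n) w"
    and k: "(P, trivial_cyclic_perm n) \<in> adjacent_swap n ^^ k"
    using exists_adjacent_swaps_to_trivial[OF n w(1)] w(2) xs(2) by auto
  then have "k \<le> (n - 1)\<^sup>2 div 4"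
    using cost by linarith
  then show ?thesis
    unfolding swap_distance_def using k by (intro INF_lower2[of k]) auto
qed

lemma le_swap_distance_reversal:
  "enat ((n - 1)\<^sup>2 div 4)
    \<le> swap_distance n (rotation_rel n `` {rev [1..<Suc n]}) (trivial_cyclic_perm n)"
  unfolding swap_distance_def
proof (intro INF_greatest)
  let ?u = "[1..<Suc n]"
  fix k assume "k \<in> {k. (rotation_rel n `` {rev ?u}, trivial_cyclic_perm n) \<in> adjacent_swap n ^^ k}"
  then have "(rotation_rel n `` {rev ?u}, rotation_rel n `` {?u}) \<in> adjacent_swap n ^^ k"
    by (simp add: trivial_cyclic_perm_def)
  then have "order_discrepancy {1..n} (rev ?u) ?u \<le> 2 * k"
    by (rule order_discrepancy_relpow_adjacent_swap)
      (intro rotation_class_in_cyclic_perms in_rotation_class upt_labeling rev_upt_labeling)+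
  moreover have "set ?u = {1..n}"
    using upt_labeling[of n] by (simp only: labelings_def mem_Collect_eq)
  ultimately show "enat ((n - 1)\<^sup>2 div 4) \<le> enat k"
    using order_discrepancy_rev_ge[of ?u] by (simp del: upt_Suc)
qed

theorem theorem1p1:
  fixes n :: nat
  assumes "n \<ge> 1"
  shows "max_swap_distance n = enat (nat \<lfloor>(real n - 1)\<^sup>2 / 4\<rfloor>)"
proof -
  have n: "0 < n"
    using assms by simp
  let ?reversal = "rotation_rel n `` {rev [1..<Suc n]}"
  have reversal: "?reversal \<in> cyclic_perms n"
    by (intro rotation_class_in_cyclic_perms rev_upt_labeling)
  have "max_swap_distance n = enat ((n - 1)\<^sup>2 div 4)"
    unfolding max_swap_distance_def
  proof (rule Max_eqI)
    show "enat ((n - 1)\<^sup>2 div 4) \<in> (\<lambda>P. swap_distance n P (trivial_cyclic_perm n)) ` cyclic_perms n"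
      using le_swap_distance_reversal swap_distance_trivial_le[OF n reversal] reversal
      by (intro image_eqI[of _ _ ?reversal] antisym)
  qed (use finite_cyclic_perms swap_distance_trivial_le[OF n] in auto)
  moreover have "\<lfloor>(real n - 1)\<^sup>2 / 4\<rfloor> = int ((n - 1)\<^sup>2 div 4)"
    using assms floor_divide_of_nat_eq[of "(n - 1)\<^sup>2" 4, where ?'a = real] by (simp add: of_nat_diff)
  ultimately show ?thesis by simp
qed

end
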